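(* Let $n\ge3$ and let $m=x_1<x_2<\cdots<x_n=M$ be any $n$ distinct integers. Then $$\frac{m^2\bar{x}^2-m(m+\bar{x})m_2'+m_2'^2}{\bar{x}-m}+\beta_1\le m_3'\le\frac{M(M+\bar{x})m_2'-M^2\bar{x}^2-m_2'^2}{M-\bar{x}}-\beta_1,$$ where, with $q$ a positive integer, $$\beta_1=\begin{cases}\frac{1}{324}(n-3)(9n^2-23n+12), & n=3q,\\[2pt] \frac{1}{324n}(n-1)(9n^3-41n^2+46n+4), & n=3q+1,\\[2pt] \frac{1}{324n}(n-2)(9n^3-32n^2+47n-20), & n=3q+2.\end{cases}$$
   Context: $\bar x=\frac1n\sum_{i=1}^n x_i$ is the arithmetic mean and $m_s'=\frac1n\sum_{i=1}^n x_i^s$ is the $s$-th moment about the origin; $m_2'^2$ means $(m_2')^2$. *)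

theory Defs
  imports Complex_Main
begin

text \<open>A sample \<open>x\<^sub>1, \<dots>, x\<^sub>n\<close> is a function on \<^typ>\<open>nat\<close> of which only the values on
  \<^term>\<open>{1..n}\<close> matter.\<close>

definition sample_mean :: "nat \<Rightarrow> (nat \<Rightarrow> real) \<Rightarrow> real" where
  "sample_mean n x = (1 / real n) * (\<Sum>i=1..n. x i)"

definition origin_moment :: "nat \<Rightarrow> (nat \<Rightarrow> real) \<Rightarrow> nat \<Rightarrow> real" where
  "origin_moment n x s = (1 / real n) * (\<Sum>i=1..n. x i ^ s)"

text \<open>For \<open>n \<ge> 3\<close> the three residues modulo \<open>3\<close> are exactly the cases \<open>n = 3q\<close>, \<open>n = 3q + 1\<close>,
  \<open>n = 3q + 2\<close> with a positive integer \<open>q\<close>.\<close>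

definition beta1 :: "nat \<Rightarrow> real" where
  "beta1 n = (let r = real n in
     if n mod 3 = 0 then
       1 / 324 * (r - 3) * (9 * r ^ 2 - 23 * r + 12)
     else if n mod 3 = 1 then
       1 / (324 * r) * (r - 1) * (9 * r ^ 3 - 41 * r ^ 2 + 46 * r + 4)
     else
       1 / (324 * r) * (r - 2) * (9 * r ^ 3 - 32 * r ^ 2 + 47 * r - 20))"

end

theory Submission
  imports Defs
begin

text \<open>After translating by \<open>m\<close>, the gap in the lower bound without \<open>\<beta>\<^sub>1\<close> is
  \<open>1/n\<close> times the minimum over \<open>a\<close> of \<open>\<Sum> y\<^sub>i (y\<^sub>i - a)\<^sup>2\<close>, where \<open>y\<^sub>i = x\<^sub>i - m \<ge> i - 1\<close>.
  Replacing the weights \<open>y\<^sub>i\<close> by \<open>i - 1\<close> only decreases this minimum, which then becomes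
  a nonnegative combination of the \<open>(y\<^sub>i - y\<^sub>j)\<^sup>2 \<ge> (i - j)\<^sup>2\<close>. Hence the minimum is at least its value for
  \<open>y\<^sub>i = i - 1\<close>, so the gap is at least \<open>(n - 1)(n + 1)(n - 2)/36\<close>, and this exceeds \<open>\<beta>\<^sub>1\<close>.
  The upper bound follows from the lower one by the reflection \<open>x \<mapsto> - x\<close>.\<close>

text \<open>Lagrange's identity: expanding each squared difference separates the double sum into
  products of single sums. It exhibits the weighted variance as a combination of squared
  differences, so samples can be compared pair by pair.\<close>

lemma weighted_variance_pairs:
  fixes w y :: "'a \<Rightarrow> real"
  shows "(\<Sum>i\<in>A. \<Sum>j\<in>A. w i * w j * (y i - y j)\<^sup>2)
    = 2 * ((\<Sum>i\<in>A. w i) * (\<Sum>i\<in>A. w i * (y i)\<^sup>2) - (\<Sum>i\<in>A. w i * y i)\<^sup>2)"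
proof -
  have "(\<Sum>i\<in>A. \<Sum>j\<in>A. w i * w j * (y i - y j)\<^sup>2)
      = (\<Sum>i\<in>A. \<Sum>j\<in>A. (w i * (y i)\<^sup>2) * w j + w i * (w j * (y j)\<^sup>2)
          - 2 * ((w i * y i) * (w j * y j)))"
    by (intro sum.cong refl) (simp add: power2_eq_square algebra_simps)
  also have "\<dots> = (\<Sum>i\<in>A. w i * (y i)\<^sup>2) * (\<Sum>i\<in>A. w i)
      + (\<Sum>i\<in>A. w i) * (\<Sum>i\<in>A. w i * (y i)\<^sup>2)
      - 2 * ((\<Sum>i\<in>A. w i * y i) * (\<Sum>i\<in>A. w i * y i))"
    by (simp only: sum.distrib sum_subtractf sum_product sum_distrib_left[of 2])
  finally show ?thesis
    by (simp add: power2_eq_square)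
qed

lemma weighted_variance_mono:
  fixes w u y :: "'a \<Rightarrow> real"
  assumes "\<And>i. i \<in> A \<Longrightarrow> 0 \<le> w i"
    and "\<And>i j. i \<in> A \<Longrightarrow> j \<in> A \<Longrightarrow> \<bar>u i - u j\<bar> \<le> \<bar>y i - y j\<bar>"
  shows "(\<Sum>i\<in>A. w i) * (\<Sum>i\<in>A. w i * (u i)\<^sup>2) - (\<Sum>i\<in>A. w i * u i)\<^sup>2
    \<le> (\<Sum>i\<in>A. w i) * (\<Sum>i\<in>A. w i * (y i)\<^sup>2) - (\<Sum>i\<in>A. w i * y i)\<^sup>2"
proof -
  have "(\<Sum>i\<in>A. \<Sum>j\<in>A. w i * w j * (u i - u j)\<^sup>2) \<le> (\<Sum>i\<in>A. \<Sum>j\<in>A. w i * w j * (y i - y j)\<^sup>2)"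
    using assms by (intro sum_mono mult_left_mono mult_nonneg_nonneg) (auto simp: abs_le_square_iff)
  then show ?thesis
    unfolding weighted_variance_pairs by simp
qed

lemma sum_weighted_square_shift:
  fixes w y :: "'a \<Rightarrow> real"
  shows "(\<Sum>i\<in>A. w i * (y i - a)\<^sup>2)
    = (\<Sum>i\<in>A. w i * (y i)\<^sup>2) - 2 * a * (\<Sum>i\<in>A. w i * y i) + a\<^sup>2 * (\<Sum>i\<in>A. w i)"
  by (simp add: sum_distrib_left sum.distrib sum_subtractf[symmetric] power2_eq_square algebra_simps
      flip: sum.distrib)

lemma sum_pred_powers:
  "(\<Sum>i=1..n. real i - 1) = real n * (real n - 1) / 2"
  "(\<Sum>i=1..n. (real i - 1) ^ 2) = real n * (real n - 1) * (2 * real n - 1) / 6"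
  "(\<Sum>i=1..n. (real i - 1) ^ 3) = (real n * (real n - 1) / 2) ^ 2"
  by (induction n) (simp_all add: field_simps power2_eq_square power3_eq_cube)

text \<open>The right-hand side is the value at \<open>t = a\<close> of
  \<open>\<Sum> y i * (y i - t)\<^sup>2\<close>, where this quadratic in \<open>t\<close> is
  smallest. Both the weights and the spread of \<open>y\<close> are then compared with those of the
  extremal sample 0, 1, ..., n - 1.\<close>

lemma separated_cubic_gap:
  fixes y :: "nat \<Rightarrow> real"
  assumes n: "n \<ge> 2"
    and y1: "y 1 = 0"
    and sep: "\<And>i j. 1 \<le> i \<Longrightarrow> i \<le> j \<Longrightarrow> j \<le> n \<Longrightarrow> real j - real i \<le> y j - y i"
  shows "(\<Sum>i=1..n. y i) > 0"
    and "real n * ((real n - 1) * (real n + 1) * (real n - 2) / 36)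
      \<le> (\<Sum>i=1..n. y i ^ 3) - (\<Sum>i=1..n. y i ^ 2)\<^sup>2 / (\<Sum>i=1..n. y i)"
proof -
  \<comment> \<open>\<open>w\<close> serves twice: as lower bound for the weights
    \<open>y i\<close>, and as the sample with the smallest admissible spacing.\<close>
  define w where "w i = real i - 1" for i :: nat
  define W where "W = (\<Sum>i=1..n. w i)"
  define S where "S = (\<Sum>i=1..n. y i)"
  define a where "a = (\<Sum>i=1..n. y i ^ 2) / S"
  have W: "W = real n * (real n - 1) / 2"
    by (simp only: W_def w_def sum_pred_powers)
  have W0: "W > 0"
    using n by (simp add: W)
  have wy: "w i \<le> y i" if "i \<in> {1..n}" for i
    using sep[of 1 i] y1 that by (simp add: w_def)
  have "W \<le> S"
    unfolding W_def S_def by (intro sum_mono wy)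
  with W0 have S0: "S > 0"
    by simp
  then show "(\<Sum>i=1..n. y i) > 0"
    by (simp add: S_def)
  define V where "V = (\<Sum>i=1..n. w i * (y i)\<^sup>2)"
  define U where "U = (\<Sum>i=1..n. w i * y i)"
  have abs: "\<bar>w i - w j\<bar> \<le> \<bar>y i - y j\<bar>" if "i \<in> {1..n}" "j \<in> {1..n}" for i j
    using sep[of i j] sep[of j i] that by (cases "i \<le> j") (auto simp: w_def)
  have "W * (\<Sum>i=1..n. w i * (w i)\<^sup>2) - (\<Sum>i=1..n. w i * w i)\<^sup>2 \<le> W * V - U\<^sup>2"
    unfolding W_def V_def U_def
    by (rule weighted_variance_mono[OF _ abs]) (auto simp: w_def)
  \<comment> \<open>The sum of the first cubes is the square of the sum, so a factor
    \<open>W\<close> can be split off below.\<close>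
  moreover have "(\<Sum>i=1..n. w i * (w i)\<^sup>2) = W\<^sup>2"
    unfolding W using sum_pred_powers(3)[of n]
    by (simp add: w_def power2_eq_square power3_eq_cube mult.assoc)
  moreover have "(\<Sum>i=1..n. w i * w i) = W * (2 * real n - 1) / 3"
    unfolding W using sum_pred_powers(2)[of n]
    by (simp add: w_def power2_eq_square)
  ultimately have "W * W\<^sup>2 - (W * (2 * real n - 1) / 3)\<^sup>2 \<le> W * V - U\<^sup>2"
    by (simp only:)
  then have "W * (W\<^sup>2 - W * (2 * real n - 1)\<^sup>2 / 9) \<le> W * V - U\<^sup>2"
    by (simp add: power2_eq_square field_simps)
  moreover have "W\<^sup>2 - W * (2 * real n - 1)\<^sup>2 / 9
      = real n * ((real n - 1) * (real n + 1) * (real n - 2) / 36)"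
    unfolding W by (simp add: power2_eq_square field_simps)
  \<comment> \<open>Completing the square: the two sides differ by
    \<open>(U - a * W)\<^sup>2\<close>, whatever \<open>a\<close> is.\<close>
  moreover have "W * V - U\<^sup>2 \<le> W * (V - 2 * a * U + a\<^sup>2 * W)"
    using zero_le_power2[of "U - a * W"] by (simp add: power2_eq_square algebra_simps)
  ultimately have "W * (real n * ((real n - 1) * (real n + 1) * (real n - 2) / 36))
      \<le> W * (V - 2 * a * U + a\<^sup>2 * W)"
    by (simp only:)
  then have "real n * ((real n - 1) * (real n + 1) * (real n - 2) / 36) \<le> V - 2 * a * U + a\<^sup>2 * W"
    using W0 by (simp only: mult_le_cancel_left_pos)
  also have "\<dots> = (\<Sum>i=1..n. w i * (y i - a)\<^sup>2)"
    by (simp only: sum_weighted_square_shift V_def U_def W_def)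
  also have "\<dots> \<le> (\<Sum>i=1..n. y i * (y i - a)\<^sup>2)"
    by (intro sum_mono mult_right_mono wy) auto
  also have "\<dots> = (\<Sum>i=1..n. y i ^ 3) - 2 * a * (\<Sum>i=1..n. y i ^ 2) + a\<^sup>2 * S"
    by (simp only: sum_weighted_square_shift S_def) (simp add: power2_eq_square power3_eq_cube mult.assoc)
  \<comment> \<open>Here the choice of \<open>a\<close> matters: \<open>a * S\<close> is the sum of
    squares, so the last two terms merge.\<close>
  also have "\<dots> = (\<Sum>i=1..n. y i ^ 3) - (\<Sum>i=1..n. y i ^ 2)\<^sup>2 / S"
    using S0 by (simp add: a_def power2_eq_square field_simps)
  finally show "real n * ((real n - 1) * (real n + 1) * (real n - 2) / 36)
      \<le> (\<Sum>i=1..n. y i ^ 3) - (\<Sum>i=1..n. y i ^ 2)\<^sup>2 / (\<Sum>i=1..n. y i)"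
    by (simp only: S_def)
qed

text \<open>Since 324 = 9 * 36, clearing denominators and common linear factors leaves polynomials
  with equal leading terms. Each of the three formulas obeys the bound for every real
  \<open>r \<ge> 3\<close>.\<close>

lemma beta1_le:
  assumes "n \<ge> 3"
  shows "beta1 n \<le> (real n - 1) * (real n + 1) * (real n - 2) / 36"
proof -
  define r where "r = real n"
  have r: "r \<ge> 3"
    using assms by (simp add: r_def)
  \<comment> \<open>Once the cubic terms cancel, the remaining inequalities are linear in
    \<open>r\<close> and \<open>r * r\<close>, and this fact settles them.\<close>
  have rr: "3 * r \<le> r * r"
    using r by (intro mult_right_mono) auto
  have "(r - 3) * (9 * r ^ 2 - 23 * r + 12) \<le> 9 * ((r - 1) * (r + 1) * (r - 2))"
    using rr r unfolding power2_eq_square by (simp only: ring_distribs)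
  then have 0: "1 / 324 * (r - 3) * (9 * r ^ 2 - 23 * r + 12) \<le> (r - 1) * (r + 1) * (r - 2) / 36"
    by simp
  have scale: "1 / (324 * r) * c * p \<le> q / 36" if "c * p \<le> 9 * r * q" for c p q
    using that r by (simp add: field_simps)
  have "(r - 1) * (9 * r ^ 3 - 41 * r ^ 2 + 46 * r + 4) \<le> (r - 1) * (9 * r * ((r + 1) * (r - 2)))"
    by (intro mult_left_mono) (use rr r in \<open>simp_all only: power2_eq_square power3_eq_cube ring_distribs\<close>)
  then have 1: "1 / (324 * r) * (r - 1) * (9 * r ^ 3 - 41 * r ^ 2 + 46 * r + 4)
      \<le> (r - 1) * (r + 1) * (r - 2) / 36"
    by (intro scale) (simp only: mult_ac)
  have "(r - 2) * (9 * r ^ 3 - 32 * r ^ 2 + 47 * r - 20) \<le> (r - 2) * (9 * r * ((r - 1) * (r + 1)))"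
    by (intro mult_left_mono) (use rr r in \<open>simp_all only: power2_eq_square power3_eq_cube ring_distribs\<close>)
  then have 2: "1 / (324 * r) * (r - 2) * (9 * r ^ 3 - 32 * r ^ 2 + 47 * r - 20)
      \<le> (r - 1) * (r + 1) * (r - 2) / 36"
    by (intro scale) (simp only: mult_ac)
  show ?thesis
    using 0 1 2 unfolding beta1_def Let_def r_def by simp
qed

text \<open>Each step between consecutive integer values gains at least 1. Integrality enters the
  argument only through this bound.\<close>

lemma strict_mono_on_Ints_separated:
  fixes x :: "nat \<Rightarrow> real"
  assumes int: "\<And>i. i \<in> {1..n} \<Longrightarrow> x i \<in> \<int>"
    and mono: "strict_mono_on {1..n} x"
    and "1 \<le> i" "i \<le> j" "j \<le> n"
  shows "real j - real i \<le> x j - x i"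
  using \<open>i \<le> j\<close> \<open>j \<le> n\<close>
proof (induction j rule: dec_induct)
  case base
  then show ?case by simp
next
  case (step k)
  then have "x k < x (Suc k)"
    using \<open>1 \<le> i\<close> by (intro strict_mono_onD[OF mono]) auto
  moreover have "x k \<in> \<int>" "x (Suc k) \<in> \<int>"
    using step \<open>1 \<le> i\<close> by (auto intro!: int)
  ultimately have "x k + 1 \<le> x (Suc k)"
    by (auto elim!: Ints_cases)
  with step show ?case by simp
qed

lemma third_moment_lower_bound:
  fixes x :: "nat \<Rightarrow> real"
  assumes n: "n \<ge> 3"
    and int: "\<And>i. i \<in> {1..n} \<Longrightarrow> x i \<in> \<int>"
    and mono: "strict_mono_on {1..n} x"
    and m: "m = x 1"
  shows "(m ^ 2 * sample_mean n x ^ 2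
            - m * (m + sample_mean n x) * origin_moment n x 2
            + origin_moment n x 2 ^ 2) / (sample_mean n x - m) + beta1 n
          \<le> origin_moment n x 3"
proof -
  define y where "y i = x i - m" for i
  define Y where "Y k = (\<Sum>i=1..n. y i ^ k) / real n" for k
  have n0: "real n > 0"
    using n by simp
  have sep: "real j - real i \<le> y j - y i" if "1 \<le> i" "i \<le> j" "j \<le> n" for i j
    using strict_mono_on_Ints_separated[OF int mono that] by (simp add: y_def)
  have y1: "y 1 = 0"
    by (simp add: y_def m)
  have S: "(\<Sum>i=1..n. y i ^ k) = real n * Y k" for k
    using n0 by (simp add: Y_def)
  have S1: "(\<Sum>i=1..n. y i) = real n * Y 1"
    using S[of 1] by simp
  have Y1: "Y 1 > 0"
    using separated_cubic_gap(1)[of n y, OF _ y1 sep] n n0 unfolding S1 by (simp add: zero_less_mult_iff)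
  have "real n * ((real n - 1) * (real n + 1) * (real n - 2) / 36)
      \<le> real n * Y 3 - (real n * Y 2)\<^sup>2 / (real n * Y 1)"
    using separated_cubic_gap(2)[of n y, OF _ y1 sep] n unfolding S S1 by simp
  also have "\<dots> = real n * (Y 3 - (Y 2)\<^sup>2 / Y 1)"
    using n0 Y1 by (simp add: power2_eq_square field_simps)
  \<comment> \<open>This is the lower bound for the sample translated to have minimum 0; the rest
    translates back.\<close>
  finally have gap: "beta1 n \<le> Y 3 - (Y 2)\<^sup>2 / Y 1"
    using n0 beta1_le[OF n] by (simp only: mult_le_cancel_left_pos)
  have mean: "sample_mean n x = Y 1 + m"
    using n0 by (simp add: sample_mean_def Y_def y_def sum_subtractf field_simps)
  have "(\<Sum>i=1..n. x i ^ 2) = (\<Sum>i=1..n. y i ^ 2 + 2 * m * y i + m ^ 2)"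
    by (simp add: y_def power2_eq_square algebra_simps)
  also have "\<dots> = real n * (Y 2 + 2 * m * Y 1 + m ^ 2)"
    unfolding sum.distrib sum_distrib_left[symmetric] S S1 by (simp add: algebra_simps)
  finally have m2: "origin_moment n x 2 = Y 2 + 2 * m * Y 1 + m ^ 2"
    using n0 by (simp add: origin_moment_def)
  have "(\<Sum>i=1..n. x i ^ 3) = (\<Sum>i=1..n. y i ^ 3 + 3 * m * y i ^ 2 + 3 * m ^ 2 * y i + m ^ 3)"
    by (simp add: y_def power2_eq_square power3_eq_cube algebra_simps)
  also have "\<dots> = real n * (Y 3 + 3 * m * Y 2 + 3 * m ^ 2 * Y 1 + m ^ 3)"
    unfolding sum.distrib sum_distrib_left[symmetric] S S1 by (simp add: algebra_simps)
  finally have m3: "origin_moment n x 3 = Y 3 + 3 * m * Y 2 + 3 * m ^ 2 * Y 1 + m ^ 3"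
    using n0 by (simp add: origin_moment_def)
  \<comment> \<open>The polynomial added to \<open>(Y 2)\<^sup>2 / Y 1\<close> is exactly the one
    added to \<open>Y 3\<close> in \<open>m3\<close>, so it cancels and \<open>gap\<close>
    remains.\<close>
  have "(m ^ 2 * (Y 1 + m) ^ 2 - m * (m + (Y 1 + m)) * (Y 2 + 2 * m * Y 1 + m ^ 2)
      + (Y 2 + 2 * m * Y 1 + m ^ 2) ^ 2) / (Y 1 + m - m)
      = (Y 2)\<^sup>2 / Y 1 + (3 * m * Y 2 + 3 * m ^ 2 * Y 1 + m ^ 3)"
    using Y1 by (simp add: field_simps power2_eq_square power3_eq_cube)
  with gap show ?thesis
    unfolding mean m2 m3 by linarith
qed

theorem theorem2p6:
  fixes n :: nat and x :: "nat \<Rightarrow> real" and m M :: real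
  assumes "n \<ge> 3"
    and "\<And>i. i \<in> {1..n} \<Longrightarrow> x i \<in> \<int>"
    and "strict_mono_on {1..n} x"
    and "m = x 1" and "M = x n"
  shows "(m ^ 2 * sample_mean n x ^ 2
            - m * (m + sample_mean n x) * origin_moment n x 2
            + origin_moment n x 2 ^ 2) / (sample_mean n x - m) + beta1 n
          \<le> origin_moment n x 3
       \<and> origin_moment n x 3
          \<le> (M * (M + sample_mean n x) * origin_moment n x 2
              - M ^ 2 * sample_mean n x ^ 2
              - origin_moment n x 2 ^ 2) / (M - sample_mean n x) - beta1 n"
proof
  show "(m ^ 2 * sample_mean n x ^ 2
            - m * (m + sample_mean n x) * origin_moment n x 2
            + origin_moment n x 2 ^ 2) / (sample_mean n x - m) + beta1 n
          \<le> origin_moment n x 3"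
    by (rule third_moment_lower_bound) (fact assms)+
next
  \<comment> \<open>Negation reverses the order, so the indices are reversed too; \<open>z\<close>
    increases again and has minimum \<open>- M\<close>.\<close>
  define z where "z i = - x (n + 1 - i)" for i
  have refl_sum: "(\<Sum>i=1..n. f (x (n + 1 - i))) = (\<Sum>i=1..n. f (x i))" for f :: "real \<Rightarrow> real"
    using sum.atLeastAtMost_rev[of "\<lambda>i. f (x i)" 1 n] by simp
  have mean: "sample_mean n z = - sample_mean n x"
    using refl_sum[of "\<lambda>t. - t"] by (simp add: sample_mean_def z_def sum_negf)
  have m2: "origin_moment n z 2 = origin_moment n x 2"
    using refl_sum[of "\<lambda>t. t ^ 2"] by (simp add: origin_moment_def z_def)
  have m3: "origin_moment n z 3 = - origin_moment n x 3"
    using refl_sum[of "\<lambda>t. t ^ 3"] by (simp add: origin_moment_def z_def sum_negf)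
  have "z i \<in> \<int>" if "i \<in> {1..n}" for i
    unfolding z_def using that by (intro Ints_minus assms(2)) auto
  moreover have "strict_mono_on {1..n} z"
  proof (rule strict_mono_onI)
    fix i j assume "i \<in> {1..n}" "j \<in> {1..n}" "i < j"
    then show "z i < z j"
      using strict_mono_onD[OF assms(3), of "n + 1 - j" "n + 1 - i"] by (simp add: z_def)
  qed
  moreover have "- M = z 1"
    by (simp add: z_def assms(5))
  ultimately have "((- M) ^ 2 * sample_mean n z ^ 2
            - (- M) * (- M + sample_mean n z) * origin_moment n z 2
            + origin_moment n z 2 ^ 2) / (sample_mean n z - (- M)) + beta1 n
          \<le> origin_moment n z 3"
    by (intro third_moment_lower_bound assms(1))
  \<comment> \<open>The denominators agree and the numerators are opposite, so negating the lower
    bound for \<open>z\<close> gives the upper bound for \<open>x\<close>.\<close>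
  moreover have "(M * (M + sample_mean n x) * origin_moment n x 2
        - M ^ 2 * sample_mean n x ^ 2 - origin_moment n x 2 ^ 2) / (M - sample_mean n x)
      = - (((- M) ^ 2 * sample_mean n z ^ 2
            - (- M) * (- M + sample_mean n z) * origin_moment n z 2
            + origin_moment n z 2 ^ 2) / (sample_mean n z - (- M)))"
    unfolding mean m2 minus_divide_left by (rule arg_cong2[where f = "(/)"]) (simp_all add: algebra_simps)
  ultimately show "origin_moment n x 3
          \<le> (M * (M + sample_mean n x) * origin_moment n x 2
              - M ^ 2 * sample_mean n x ^ 2
              - origin_moment n x 2 ^ 2) / (M - sample_mean n x) - beta1 n"
    unfolding m3 by linarith
qed

end
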